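(* Let $(C,\Delta_{-1},\Delta_0,\Delta_1,\alpha)$ be a Hom-tridendriform coalgebra and let $\beta:C\to C$ be an endomorphism of it. Then $(C,\ \Delta_{-1}\circ\beta,\ \Delta_0\circ\beta,\ \Delta_1\circ\beta,\ \beta\circ\alpha)$ is a Hom-tridendriform coalgebra.
   Context: All vector spaces are over a field $\mathbb{F}$ of characteristic $0$. A Hom-tridendriform coalgebra $(C,\Delta_{-1},\Delta_0,\Delta_1,\alpha)$ is a vector space $C$ with linear maps $\Delta_{-1},\Delta_0,\Delta_1:C\to C\otimes C$ and a linear map $\alpha:C\to C$ such that (1) $(\Delta_{-1}\otimes\alpha)\circ\Delta_{-1}=(\alpha\otimes\Delta_{-1}+\alpha\otimes\Delta_1+\alpha\otimes\Delta_0)\circ\Delta_{-1}$; (2) $(\Delta_1\otimes\alpha)\circ\Delta_{-1}=(\alpha\otimes\Delta_{-1})\circ\Delta_1$; (3) $(\alpha\otimes\Delta_1)\circ\Delta_1=(\Delta_{-1}\otimes\alpha+\Delta_1\otimes\alpha+\Delta_0\otimes\alpha)\circ\Delta_1$; (4) $(\Delta_{-1}\otimes\alpha)\circ\Delta_0=(\alpha\otimes\Delta_1)\circ\Delta_0$; (5) $(\Delta_1\otimes\alpha)\circ\Delta_0=(\alpha\otimes\Delta_0)\circ\Delta_1$; (6) $(\Delta_0\otimes\alpha)\circ\Delta_{-1}=(\alpha\otimes\Delta_{-1})\circ\Delta_0$; (7) $(\Delta_0\otimes\alpha)\circ\Delta_0=(\alpha\otimes\Delta_0)\circ\Delta_0$.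 An endomorphism of it is a linear map $\beta:C\to C$ with $\beta\circ\alpha=\alpha\circ\beta$ and $\Delta_i\circ\beta=(\beta\otimes\beta)\circ\Delta_i$ for $i=-1,0,1$. *)

theory Defs
  imports "HOL-Algebra.AbelCoset" "Jordan_Normal_Form.Missing_VectorSpace"
begin

section \<open>Free modules, quotient modules\<close>

text \<open>
  Modules are the records of \<^theory>\<open>HOL-Algebra.Module\<close>, which extend rings; their multiplicative
  fields \<^const>\<open>mult\<close> and \<^const>\<open>one\<close> play no role and are left unspecified.
\<close>

definition free_module :: "('f, 'm) ring_scheme \<Rightarrow> 'x set \<Rightarrow> ('f, 'x \<Rightarrow> 'f) module"
  where "free_module F X =
    \<lparr>carrier = {t. (\<forall>x\<in>X. t x \<in> carrier F) \<and> (\<forall>x. x \<notin> X \<longrightarrow> t x = \<zero>\<^bsub>F\<^esub>)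
                 \<and> finite {x. t x \<noteq> \<zero>\<^bsub>F\<^esub>}},
     mult = undefined, one = undefined,
     zero = (\<lambda>x. \<zero>\<^bsub>F\<^esub>),
     add = (\<lambda>s t x. s x \<oplus>\<^bsub>F\<^esub> t x),
     smult = (\<lambda>a t x. a \<otimes>\<^bsub>F\<^esub> t x)\<rparr>"

definition free_gen :: "('f, 'm) ring_scheme \<Rightarrow> 'x \<Rightarrow> 'x \<Rightarrow> 'f"
  where "free_gen F x = (\<lambda>y. if y = x then \<one>\<^bsub>F\<^esub> else \<zero>\<^bsub>F\<^esub>)"

definition quotient_module :: "('f, 'x, 'm) module_scheme \<Rightarrow> 'x set \<Rightarrow> ('f, 'x set) module"
  where "quotient_module M N =
    \<lparr>carrier = a_rcosets\<^bsub>M\<^esub> N,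
     mult = undefined, one = undefined,
     zero = N,
     add = (\<lambda>A B. A <+>\<^bsub>M\<^esub> B),
     smult = (\<lambda>a A. \<Union>t\<in>A. N +>\<^bsub>M\<^esub> (a \<odot>\<^bsub>M\<^esub> t))\<rparr>"

section \<open>Tensor products\<close>

definition tensor_relations ::
  "('f, 'm) ring_scheme \<Rightarrow> ('f, 'v, 'n) module_scheme \<Rightarrow> ('f, 'w, 'o) module_scheme
    \<Rightarrow> ('v \<times> 'w \<Rightarrow> 'f) set"
  where "tensor_relations F V W =
   (let M = free_module F (carrier V \<times> carrier W) in
      {free_gen F (v \<oplus>\<^bsub>V\<^esub> v', w) \<ominus>\<^bsub>M\<^esub> (free_gen F (v, w) \<oplus>\<^bsub>M\<^esub> free_gen F (v', w)) | v v' w.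
          v \<in> carrier V \<and> v' \<in> carrier V \<and> w \<in> carrier W}
    \<union> {free_gen F (v, w \<oplus>\<^bsub>W\<^esub> w') \<ominus>\<^bsub>M\<^esub> (free_gen F (v, w) \<oplus>\<^bsub>M\<^esub> free_gen F (v, w')) | v w w'.
          v \<in> carrier V \<and> w \<in> carrier W \<and> w' \<in> carrier W}
    \<union> {free_gen F (a \<odot>\<^bsub>V\<^esub> v, w) \<ominus>\<^bsub>M\<^esub> (a \<odot>\<^bsub>M\<^esub> free_gen F (v, w)) | a v w.
          a \<in> carrier F \<and> v \<in> carrier V \<and> w \<in> carrier W}
    \<union> {free_gen F (v, a \<odot>\<^bsub>W\<^esub> w) \<ominus>\<^bsub>M\<^esub> (a \<odot>\<^bsub>M\<^esub> free_gen F (v, w)) | a v w.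
          a \<in> carrier F \<and> v \<in> carrier V \<and> w \<in> carrier W})"

definition tensor_kernel ::
  "('f, 'm) ring_scheme \<Rightarrow> ('f, 'v, 'n) module_scheme \<Rightarrow> ('f, 'w, 'o) module_scheme
    \<Rightarrow> ('v \<times> 'w \<Rightarrow> 'f) set"
  where "tensor_kernel F V W =
    module.span F (free_module F (carrier V \<times> carrier W)) (tensor_relations F V W)"

definition tensor ::
  "('f, 'm) ring_scheme \<Rightarrow> ('f, 'v, 'n) module_scheme \<Rightarrow> ('f, 'w, 'o) module_scheme
    \<Rightarrow> ('f, ('v \<times> 'w \<Rightarrow> 'f) set) module"
  where "tensor F V W =
    quotient_module (free_module F (carrier V \<times> carrier W)) (tensor_kernel F V W)"

definition pure_tensor ::
  "('f, 'm) ring_scheme \<Rightarrow> ('f, 'v, 'n) module_scheme \<Rightarrow> ('f, 'w, 'o) module_scheme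
    \<Rightarrow> 'v \<Rightarrow> 'w \<Rightarrow> ('v \<times> 'w \<Rightarrow> 'f) set"
  where "pure_tensor F V W v w =
    tensor_kernel F V W +>\<^bsub>free_module F (carrier V \<times> carrier W)\<^esub> free_gen F (v, w)"

definition bilinear_map ::
  "('f, 'm) ring_scheme \<Rightarrow> ('f, 'v, 'n) module_scheme \<Rightarrow> ('f, 'w, 'o) module_scheme
    \<Rightarrow> ('f, 'u, 'p) module_scheme \<Rightarrow> ('v \<Rightarrow> 'w \<Rightarrow> 'u) \<Rightarrow> bool"
  where "bilinear_map F V W U h \<longleftrightarrow>
    (\<forall>w\<in>carrier W. (\<lambda>v. h v w) \<in> module_hom F V U) \<and>
    (\<forall>v\<in>carrier V. h v \<in> module_hom F W U)"

text \<open>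
  The unique linear map that sends every \<open>v \<otimes> w\<close> to \<open>h v w\<close>; it exists for bilinear \<open>h\<close>, see
  \<open>tensor_universal\<close> below. (Extensionality makes it unique as a function on the whole type.)
\<close>

definition tensor_lift ::
  "('f, 'm) ring_scheme \<Rightarrow> ('f, 'v, 'n) module_scheme \<Rightarrow> ('f, 'w, 'o) module_scheme
    \<Rightarrow> ('f, 'u, 'p) module_scheme \<Rightarrow> ('v \<Rightarrow> 'w \<Rightarrow> 'u) \<Rightarrow> ('v \<times> 'w \<Rightarrow> 'f) set \<Rightarrow> 'u"
  where "tensor_lift F V W U h =
    (THE \<phi>. \<phi> \<in> extensional (carrier (tensor F V W)) \<and> \<phi> \<in> module_hom F (tensor F V W) U \<and>
       (\<forall>v\<in>carrier V. \<forall>w\<in>carrier W. \<phi> (pure_tensor F V W v w) = h v w))"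

text \<open>\<open>f \<otimes> g : V \<otimes> W \<rightarrow> V' \<otimes> W'\<close>\<close>

definition tensor_map ::
  "('f, 'm) ring_scheme \<Rightarrow> ('f, 'v, 'n) module_scheme \<Rightarrow> ('f, 'w, 'o) module_scheme
    \<Rightarrow> ('f, 'v1, 'p) module_scheme \<Rightarrow> ('f, 'w1, 'q) module_scheme
    \<Rightarrow> ('v \<Rightarrow> 'v1) \<Rightarrow> ('w \<Rightarrow> 'w1) \<Rightarrow> ('v \<times> 'w \<Rightarrow> 'f) set \<Rightarrow> ('v1 \<times> 'w1 \<Rightarrow> 'f) set"
  where "tensor_map F V W V' W' f g =
    tensor_lift F V W (tensor F V' W') (\<lambda>v w. pure_tensor F V' W' (f v) (g w))"

text \<open>
  The canonical isomorphism \<open>(U \<otimes> V) \<otimes> W \<rightarrow> U \<otimes> (V \<otimes> W)\<close>, \<open>(u \<otimes> v) \<otimes> w \<mapsto> u \<otimes> (v \<otimes> w)\<close>.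
\<close>

definition tensor_assoc ::
  "('f, 'm) ring_scheme \<Rightarrow> ('f, 'u, 'n) module_scheme \<Rightarrow> ('f, 'v, 'o) module_scheme
    \<Rightarrow> ('f, 'w, 'p) module_scheme
    \<Rightarrow> (('u \<times> 'v \<Rightarrow> 'f) set \<times> 'w \<Rightarrow> 'f) set \<Rightarrow> ('u \<times> ('v \<times> 'w \<Rightarrow> 'f) set \<Rightarrow> 'f) set"
  where "tensor_assoc F U V W =
    tensor_lift F (tensor F U V) W (tensor F U (tensor F V W))
      (\<lambda>t w. tensor_lift F U V (tensor F U (tensor F V W))
               (\<lambda>u v. pure_tensor F U (tensor F V W) u (pure_tensor F V W v w)) t)"

subsection \<open>Universal property\<close>

lemma free_module_simps [simp]:
  "zero (free_module F X) = (\<lambda>x. \<zero>\<^bsub>F\<^esub>)"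
  "add (free_module F X) = (\<lambda>s t x. s x \<oplus>\<^bsub>F\<^esub> t x)"
  "smult (free_module F X) = (\<lambda>a t x. a \<otimes>\<^bsub>F\<^esub> t x)"
  by (simp_all add: free_module_def)

lemma (in cring) free_module_is_module: "module R (free_module R X)"
proof -
  let ?M = "free_module R X"
  have c: "t x \<in> carrier R" if "t \<in> carrier ?M" for t x
    using that by (cases "x \<in> X") (auto simp: free_module_def)
  have fin: "finite {x. t x \<noteq> \<zero>}" if "t \<in> carrier ?M" for t
    using that by (auto simp: free_module_def)
  have add: "s \<oplus>\<^bsub>?M\<^esub> t \<in> carrier ?M" if "s \<in> carrier ?M" "t \<in> carrier ?M" for s t
  proof -
    have "{x. s x \<oplus> t x \<noteq> \<zero>} \<subseteq> {x. s x \<noteq> \<zero>} \<union> {x. t x \<noteq> \<zero>}" by auto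
    then have "finite {x. s x \<oplus> t x \<noteq> \<zero>}"
      using fin[OF that(1)] fin[OF that(2)] by (meson finite_UnI finite_subset)
    then show ?thesis using that by (auto simp: free_module_def)
  qed
  have sm: "a \<odot>\<^bsub>?M\<^esub> t \<in> carrier ?M" if "a \<in> carrier R" "t \<in> carrier ?M" for a t
  proof -
    have "{x. a \<otimes> t x \<noteq> \<zero>} \<subseteq> {x. t x \<noteq> \<zero>}" using that by auto
    then have "finite {x. a \<otimes> t x \<noteq> \<zero>}"
      using fin[OF that(2)] by (meson finite_subset)
    then show ?thesis using that by (auto simp: free_module_def)
  qed
  have ng: "\<exists>s\<in>carrier ?M. s \<oplus>\<^bsub>?M\<^esub> t = \<zero>\<^bsub>?M\<^esub>" if "t \<in> carrier ?M" for t
  proof (intro bexI)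
    show "((\<ominus> \<one>) \<odot>\<^bsub>?M\<^esub> t) \<oplus>\<^bsub>?M\<^esub> t = \<zero>\<^bsub>?M\<^esub>"
      using c[OF that] by (auto simp: l_minus l_neg)
    show "(\<ominus> \<one>) \<odot>\<^bsub>?M\<^esub> t \<in> carrier ?M" using sm that by blast
  qed
  have z: "\<zero>\<^bsub>?M\<^esub> \<in> carrier ?M" by (auto simp: free_module_def)
  have ab: "abelian_group ?M"
    by (rule abelian_groupI) (use add ng c z in \<open>auto simp: a_ac\<close>)
  show ?thesis
    by (rule moduleI) (use ab sm c in \<open>auto simp: cring_axioms l_distr r_distr m_assoc\<close>)
qed

context module begin

context
  fixes N assumes N: "LinearCombinations.submodule R N M"
begin

interpretation N: LinearCombinations.submodule R N M by (rule N)


lemma submodule_abelian_subgroup: "abelian_subgroup N M"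
proof -
  have inv: "inv\<^bsub>add_monoid M\<^esub> x \<in> N" if "x \<in> N" for x
  proof -
    have "(\<ominus> \<one>) \<odot>\<^bsub>M\<^esub> x \<in> N" using that by blast
    moreover have "x \<in> carrier M" using that N.subset by auto
    ultimately show ?thesis using smult_l_minus[of "\<one>" x]
      by (simp add: a_inv_def)
  qed
  have "additive_subgroup N M"
    by (rule additive_subgroupI, rule subgroup.intro)
       (use N.subset N.m_closed N.zero_closed inv in \<open>auto simp: \<close>)
  then show ?thesis by (rule abelian_subgroupI3) (rule M.abelian_group_axioms)
qed

interpretation S: abelian_subgroup N M by (rule submodule_abelian_subgroup)

lemma quotient_eq: "x \<in> carrier M \<Longrightarrow> y \<in> carrier M \<Longrightarrow> N +>\<^bsub>M\<^esub> x = N +>\<^bsub>M\<^esub> y \<longleftrightarrow> x \<ominus>\<^bsub>M\<^esub> y \<in> N"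
proof -
  assume x: "x \<in> carrier M" and y: "y \<in> carrier M"
  have "N +>\<^bsub>M\<^esub> x = N +>\<^bsub>M\<^esub> y \<longleftrightarrow> x \<in> N +>\<^bsub>M\<^esub> y"
    using S.a_rcos_self[OF x] M.a_repr_independence[OF _ y S.a_subgroup] by blast
  then show ?thesis using S.a_rcos_module[OF y x] by (simp add: M.minus_eq)
qed

lemma quotient_carrier: "carrier (quotient_module M N) = (\<lambda>x. N +>\<^bsub>M\<^esub> x) ` carrier M"
  by (auto simp: quotient_module_def A_RCOSETS_def')

lemma quotient_add: "x \<in> carrier M \<Longrightarrow> y \<in> carrier M \<Longrightarrow>
   (N +>\<^bsub>M\<^esub> x) \<oplus>\<^bsub>quotient_module M N\<^esub> (N +>\<^bsub>M\<^esub> y) = N +>\<^bsub>M\<^esub> (x \<oplus>\<^bsub>M\<^esub> y)"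
  by (simp add: quotient_module_def S.a_rcos_sum)

lemma quotient_zero: "\<zero>\<^bsub>quotient_module M N\<^esub> = N +>\<^bsub>M\<^esub> \<zero>\<^bsub>M\<^esub>"
  using N.subset by (simp add: quotient_module_def)

lemma quotient_smult:
  assumes a: "a \<in> carrier R" and x: "x \<in> carrier M"
  shows "a \<odot>\<^bsub>quotient_module M N\<^esub> (N +>\<^bsub>M\<^esub> x) = N +>\<^bsub>M\<^esub> (a \<odot>\<^bsub>M\<^esub> x)"
proof -
  have eq: "N +>\<^bsub>M\<^esub> (a \<odot>\<^bsub>M\<^esub> t) = N +>\<^bsub>M\<^esub> (a \<odot>\<^bsub>M\<^esub> x)" if t: "t \<in> N +>\<^bsub>M\<^esub> x" for t
  proof -
    obtain n where n: "n \<in> N" "t = n \<oplus>\<^bsub>M\<^esub> x" using t by (auto simp: a_r_coset_def')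
    have "n \<in> carrier M" using n N.subset by auto
    then have "a \<odot>\<^bsub>M\<^esub> t \<ominus>\<^bsub>M\<^esub> a \<odot>\<^bsub>M\<^esub> x = a \<odot>\<^bsub>M\<^esub> n"
      unfolding n(2) smult_r_distr[OF a \<open>n \<in> carrier M\<close> x] M.minus_eq
      using a x \<open>n \<in> carrier M\<close> M.a_assoc M.r_neg smult_closed M.r_zero M.a_inv_closed by metis
    moreover have "a \<odot>\<^bsub>M\<^esub> n \<in> N" using a n by blast
    ultimately show ?thesis
      using quotient_eq[of "a \<odot>\<^bsub>M\<^esub> t" "a \<odot>\<^bsub>M\<^esub> x"] a x n \<open>n \<in> carrier M\<close> by auto
  qed
  have "x \<in> N +>\<^bsub>M\<^esub> x" using S.a_rcos_self x by simp
  then have "(\<Union>t\<in>N +>\<^bsub>M\<^esub> x. N +>\<^bsub>M\<^esub> (a \<odot>\<^bsub>M\<^esub> t)) = N +>\<^bsub>M\<^esub> (a \<odot>\<^bsub>M\<^esub> x)"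
    by (intro SUP_eq_const eq) blast
  then show ?thesis by (simp add: quotient_module_def)
qed

lemma quotient_module_is_module: "module R (quotient_module M N)"
proof (rule moduleI)
  show "cring R" by unfold_locales
  show "abelian_group (quotient_module M N)"
  proof (rule abelian_groupI)
    show "\<exists>y\<in>carrier (quotient_module M N). y \<oplus>\<^bsub>quotient_module M N\<^esub> x = \<zero>\<^bsub>quotient_module M N\<^esub>"
      if x: "x \<in> carrier (quotient_module M N)" for x
    proof -
      obtain u where u: "u \<in> carrier M" "x = N +>\<^bsub>M\<^esub> u" using x quotient_carrier by auto
      show ?thesis
        by (rule bexI[of _ "N +>\<^bsub>M\<^esub> (\<ominus>\<^bsub>M\<^esub> u)"]) (use u in \<open>auto simp: quotient_carrier quotient_add quotient_zero M.l_neg\<close>)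
    qed
  qed (auto simp: quotient_carrier quotient_add quotient_zero M.a_ac)
qed (auto simp: quotient_carrier quotient_add quotient_smult smult_l_distr smult_r_distr smult_assoc1)

lemma quotient_lift:
  assumes U: "module R U" and h: "h \<in> module_hom R M U" and k: "\<And>x. x \<in> N \<Longrightarrow> h x = \<zero>\<^bsub>U\<^esub>"
  shows "\<exists>g \<in> module_hom R (quotient_module M N) U. \<forall>x\<in>carrier M. g (N +>\<^bsub>M\<^esub> x) = h x"
proof -
  interpret U: module R U by fact
  interpret h: mod_hom R M U h
    by (simp add: mod_hom_def mod_hom_axioms_def h U module_axioms)
  define g where "g A = h (SOME t. t \<in> carrier M \<and> A = N +>\<^bsub>M\<^esub> t)" for A
  have g: "g (N +>\<^bsub>M\<^esub> x) = h x" if x: "x \<in> carrier M" for x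
  proof -
    define t where "t = (SOME t. t \<in> carrier M \<and> N +>\<^bsub>M\<^esub> x = N +>\<^bsub>M\<^esub> t)"
    have "t \<in> carrier M \<and> N +>\<^bsub>M\<^esub> x = N +>\<^bsub>M\<^esub> t"
      unfolding t_def by (rule someI[of _ x]) (use x in auto)
    then have t: "t \<in> carrier M" "t \<ominus>\<^bsub>M\<^esub> x \<in> N" using quotient_eq[of t x] x by auto
    then have "h t \<ominus>\<^bsub>U\<^esub> h x = \<zero>\<^bsub>U\<^esub>" using k[OF t(2)] x by simp
    moreover have "h t \<in> carrier U" "h x \<in> carrier U" using t x by auto
    ultimately have "h t = h x"
      using U.minus_equality[of "h t" "\<ominus>\<^bsub>U\<^esub> h x"] by (simp add: U.minus_eq)
    then show ?thesis by (simp add: g_def t_def)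
  qed
  have "g \<in> module_hom R (quotient_module M N) U"
    by (auto simp: module_hom_def quotient_carrier quotient_add quotient_smult g)
  then show ?thesis using g by blast
qed

end
end
lemma free_carrier: "t \<in> carrier (free_module F X) \<longleftrightarrow>
   (\<forall>x\<in>X. t x \<in> carrier F) \<and> (\<forall>x. x \<notin> X \<longrightarrow> t x = \<zero>\<^bsub>F\<^esub>) \<and> finite {x. t x \<noteq> \<zero>\<^bsub>F\<^esub>}"
  by (simp add: free_module_def)

lemma (in cring) free_gen_closed: "x \<in> X \<Longrightarrow> free_gen R x \<in> carrier (free_module R X)"
proof -
  assume "x \<in> X"
  moreover have "finite {y. free_gen R x y \<noteq> \<zero>}"
    by (rule finite_subset[of _ "{x}"]) (auto simp: free_gen_def)
  ultimately show ?thesis by (auto simp: free_gen_def free_carrier)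
qed

lemma (in module) free_lift:
  assumes h: "h \<in> X \<rightarrow> carrier M"
  shows "\<exists>g \<in> module_hom R (free_module R X) M. \<forall>x\<in>X. g (free_gen R x) = h x"
proof -
  define g where "g t = (\<Oplus>\<^bsub>M\<^esub>x\<in>{x. t x \<noteq> \<zero>}. t x \<odot>\<^bsub>M\<^esub> h x)" for t
  have g: "g t = (\<Oplus>\<^bsub>M\<^esub>x\<in>A. t x \<odot>\<^bsub>M\<^esub> h x)"
    if "finite A" "A \<subseteq> X" "{x. t x \<noteq> \<zero>} \<subseteq> A" "t \<in> carrier (free_module R X)" for A t
    unfolding g_def
    by (rule M.add.finprod_mono_neutral_cong_left) (use that h in \<open>auto simp: free_carrier Pi_iff\<close>)
  have cl: "(\<lambda>x. t x \<odot>\<^bsub>M\<^esub> h x) \<in> A \<rightarrow> carrier M" if "A \<subseteq> X" "t \<in> carrier (free_module R X)" for A t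
    using that h by (auto simp: free_carrier Pi_iff subset_iff)
  have supp: "{x. t x \<noteq> \<zero>} \<subseteq> X" "finite {x. t x \<noteq> \<zero>}" if "t \<in> carrier (free_module R X)" for t
    using that by (auto simp: free_carrier)
  interpret Fr: module R "free_module R X" by (rule free_module_is_module)
  have "g \<in> module_hom R (free_module R X) M"
    unfolding module_hom_def
  proof (safe)
    fix t assume t: "t \<in> carrier (free_module R X)"
    show "g t \<in> carrier M" unfolding g_def by (rule M.finsum_closed) (rule cl[OF supp(1)[OF t] t])
  next
    fix s t assume s: "s \<in> carrier (free_module R X)" and t: "t \<in> carrier (free_module R X)"
    let ?A = "{x. s x \<noteq> \<zero>} \<union> {x. t x \<noteq> \<zero>}"
    have A: "finite ?A" "?A \<subseteq> X" using supp[OF s] supp[OF t] by auto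
    have st: "s \<oplus>\<^bsub>free_module R X\<^esub> t \<in> carrier (free_module R X)" using s t by blast
    have "g (s \<oplus>\<^bsub>free_module R X\<^esub> t) = (\<Oplus>\<^bsub>M\<^esub>x\<in>?A. (s \<oplus>\<^bsub>free_module R X\<^esub> t) x \<odot>\<^bsub>M\<^esub> h x)"
      by (rule g[OF A _ st]) auto
    also have "\<dots> = (\<Oplus>\<^bsub>M\<^esub>x\<in>?A. s x \<odot>\<^bsub>M\<^esub> h x \<oplus>\<^bsub>M\<^esub> t x \<odot>\<^bsub>M\<^esub> h x)"
    proof (rule M.finsum_cong')
      show "(\<lambda>x. s x \<odot>\<^bsub>M\<^esub> h x \<oplus>\<^bsub>M\<^esub> t x \<odot>\<^bsub>M\<^esub> h x) \<in> ?A \<rightarrow> carrier M"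
        using cl[OF A(2) s] cl[OF A(2) t] by (auto simp: Pi_iff)
      fix x assume "x \<in> ?A"
      then have "x \<in> X" using A by blast
      then show "(s \<oplus>\<^bsub>free_module R X\<^esub> t) x \<odot>\<^bsub>M\<^esub> h x = s x \<odot>\<^bsub>M\<^esub> h x \<oplus>\<^bsub>M\<^esub> t x \<odot>\<^bsub>M\<^esub> h x"
        using s t h by (auto simp: free_carrier smult_l_distr Pi_iff)
    qed simp
    also have "\<dots> = g s \<oplus>\<^bsub>M\<^esub> g t"
      using M.finsum_addf[OF cl[OF A(2) s] cl[OF A(2) t]] g[OF A _ s] g[OF A _ t] by simp
    finally show "g (s \<oplus>\<^bsub>free_module R X\<^esub> t) = g s \<oplus>\<^bsub>M\<^esub> g t" .
  next
    fix a t assume a: "a \<in> carrier R" and t: "t \<in> carrier (free_module R X)"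
    let ?A = "{x. t x \<noteq> \<zero>}"
    have at: "a \<odot>\<^bsub>free_module R X\<^esub> t \<in> carrier (free_module R X)" using a t by blast
    have "g (a \<odot>\<^bsub>free_module R X\<^esub> t) = (\<Oplus>\<^bsub>M\<^esub>x\<in>?A. (a \<odot>\<^bsub>free_module R X\<^esub> t) x \<odot>\<^bsub>M\<^esub> h x)"
      by (rule g[OF supp(2,1)[OF t] _ at]) (use a in auto)
    also have "\<dots> = (\<Oplus>\<^bsub>M\<^esub>x\<in>?A. a \<odot>\<^bsub>M\<^esub> (t x \<odot>\<^bsub>M\<^esub> h x))"
    proof (rule M.finsum_cong')
      show "(\<lambda>x. a \<odot>\<^bsub>M\<^esub> (t x \<odot>\<^bsub>M\<^esub> h x)) \<in> ?A \<rightarrow> carrier M"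
        using cl[OF supp(1)[OF t] t] a by (auto simp: Pi_iff)
      fix x assume "x \<in> ?A"
      then have "x \<in> X" using supp(1)[OF t] by blast
      then show "(a \<odot>\<^bsub>free_module R X\<^esub> t) x \<odot>\<^bsub>M\<^esub> h x = a \<odot>\<^bsub>M\<^esub> (t x \<odot>\<^bsub>M\<^esub> h x)"
        using a t h by (auto simp: free_carrier smult_assoc1 Pi_iff)
    qed simp
    also have "\<dots> = a \<odot>\<^bsub>M\<^esub> g t"
      unfolding g_def by (rule finsum_smult_ldistr[symmetric]) (use supp[OF t] a cl[OF supp(1)[OF t] t] in auto)
    finally show "g (a \<odot>\<^bsub>free_module R X\<^esub> t) = a \<odot>\<^bsub>M\<^esub> g t" .
  qed
  moreover have "g (free_gen R x) = h x" if x: "x \<in> X" for x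
  proof -
    have "g (free_gen R x) = (\<Oplus>\<^bsub>M\<^esub>y\<in>{x}. free_gen R x y \<odot>\<^bsub>M\<^esub> h y)"
      by (rule g) (use x free_gen_closed[OF x] in \<open>auto simp: free_gen_def\<close>)
    also have "\<dots> = h x" using x h by (auto simp: free_gen_def Pi_iff)
    finally show ?thesis .
  qed
  ultimately show ?thesis by blast
qed

lemma (in module) free_hom_eqI:
  assumes f: "f \<in> module_hom R (free_module R X) M" and g: "g \<in> module_hom R (free_module R X) M"
    and eq: "\<And>x. x \<in> X \<Longrightarrow> f (free_gen R x) = g (free_gen R x)"
    and t: "t \<in> carrier (free_module R X)"
  shows "f t = g t"
proof -
  interpret Fr: module R "free_module R X" by (rule free_module_is_module)
  interpret f: mod_hom R "free_module R X" M f
    by (simp add: mod_hom_def mod_hom_axioms_def f module_axioms Fr.module_axioms)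
  interpret g: mod_hom R "free_module R X" M g
    by (simp add: mod_hom_def mod_hom_axioms_def g module_axioms Fr.module_axioms)
  have "\<forall>t. t \<in> carrier (free_module R X) \<longrightarrow> {x. t x \<noteq> \<zero>} \<subseteq> A \<longrightarrow> f t = g t" if "finite A" for A
    using that
  proof (induction A rule: finite_induct)
    case empty
    have "t = \<zero>\<^bsub>free_module R X\<^esub>" if "{x. t x \<noteq> \<zero>} \<subseteq> {}" for t using that by auto
    then show ?case using f.f0_is_0 g.f0_is_0 by metis
  next
    case (insert a A)
    show ?case
    proof (intro allI impI)
      fix t assume t: "t \<in> carrier (free_module R X)" and s: "{x. t x \<noteq> \<zero>} \<subseteq> insert a A"
      show "f t = g t"
      proof (cases "a \<in> X")
        case False
        then show ?thesis using insert t s by (auto simp: free_carrier)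
      next
        case a: True
        have ta: "t a \<in> carrier R" using t a by (simp add: free_carrier)
        have tc: "t x \<in> carrier R" for x using t by (cases "x \<in> X") (auto simp: free_carrier)
        define u where "u = (\<lambda>x. if x = a then \<zero> else t x)"
        have "finite {x. u x \<noteq> \<zero>}"
          by (rule finite_subset[of _ "{x. t x \<noteq> \<zero>}"]) (use t in \<open>auto simp: u_def free_carrier\<close>)
        then have u: "u \<in> carrier (free_module R X)" using t by (auto simp: u_def free_carrier)
        have "{x. u x \<noteq> \<zero>} \<subseteq> A" using s by (auto simp: u_def)
        then have fu: "f u = g u" using insert u by blast
        have tu: "t = u \<oplus>\<^bsub>free_module R X\<^esub> (t a \<odot>\<^bsub>free_module R X\<^esub> free_gen R a)"
          using ta tc by (auto simp: u_def free_gen_def fun_eq_iff)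
        have w: "t a \<odot>\<^bsub>free_module R X\<^esub> free_gen R a \<in> carrier (free_module R X)"
          by (rule Fr.smult_closed[OF ta free_gen_closed[OF a]])
        show ?thesis
          using f.f_add[OF u w] g.f_add[OF u w] f.f_smult[OF ta free_gen_closed[OF a]]
            g.f_smult[OF ta free_gen_closed[OF a]] fu eq[OF a] tu by simp
      qed
    qed
  qed
  then show ?thesis using t by (auto simp: free_carrier)
qed


lemma tensor_relations_closed:
  assumes "module F V" "module F W"
  shows "tensor_relations F V W \<subseteq> carrier (free_module F (carrier V \<times> carrier W))"
proof -
  interpret V: module F V by fact
  interpret W: module F W by fact
  interpret M: module F "free_module F (carrier V \<times> carrier W)" by (rule V.free_module_is_module)
  have "free_gen F (v, w) \<in> carrier (free_module F (carrier V \<times> carrier W))"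
    if "v \<in> carrier V" "w \<in> carrier W" for v w
    using that by (intro V.free_gen_closed) auto
  then show ?thesis
    unfolding tensor_relations_def Let_def
    by (auto simp del: free_module_simps intro!: M.minus_closed M.a_closed M.smult_closed)
qed

lemma tensor_kernel_submodule:
  assumes "module F V" "module F W"
  shows "LinearCombinations.submodule F (tensor_kernel F V W) (free_module F (carrier V \<times> carrier W))"
proof -
  interpret V: module F V by fact
  interpret M: module F "free_module F (carrier V \<times> carrier W)" by (rule V.free_module_is_module)
  show ?thesis unfolding tensor_kernel_def
    by (rule M.span_is_submodule[OF tensor_relations_closed[OF assms]])
qed

lemma tensor_module:
  assumes "module F V" "module F W"
  shows "module F (tensor F V W)"
proof -
  interpret V: module F V by fact
  interpret M: module F "free_module F (carrier V \<times> carrier W)" by (rule V.free_module_is_module)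
  show ?thesis unfolding tensor_def by (rule M.quotient_module_is_module[OF tensor_kernel_submodule[OF assms]])
qed

lemma tensor_vectorspace:
  assumes "vectorspace F V" "vectorspace F W"
  shows "vectorspace F (tensor F V W)"
  using assms tensor_module by (auto simp: vectorspace_def)

lemma tensor_bilinear:
  assumes "module F V" "module F W"
  shows "bilinear_map F V W (tensor F V W) (pure_tensor F V W)"
proof -
  interpret V: module F V by fact
  interpret W: module F W by fact
  let ?M = "free_module F (carrier V \<times> carrier W)"
  let ?N = "tensor_kernel F V W"
  interpret M: module F ?M by (rule V.free_module_is_module)
  note sub = tensor_kernel_submodule[OF assms]
  have rel: "tensor_relations F V W \<subseteq> ?N"
    unfolding tensor_kernel_def by (rule M.in_own_span[OF tensor_relations_closed[OF assms]])
  have gen: "free_gen F (v, w) \<in> carrier ?M" if "v \<in> carrier V" "w \<in> carrier W" for v w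
    using that by (intro V.free_gen_closed) auto
  have 1: "pure_tensor F V W (v \<oplus>\<^bsub>V\<^esub> v') w = pure_tensor F V W v w \<oplus>\<^bsub>tensor F V W\<^esub> pure_tensor F V W v' w"
    if "v \<in> carrier V" "v' \<in> carrier V" "w \<in> carrier W" for v v' w
  proof -
    have "free_gen F (v \<oplus>\<^bsub>V\<^esub> v', w) \<ominus>\<^bsub>?M\<^esub> (free_gen F (v, w) \<oplus>\<^bsub>?M\<^esub> free_gen F (v', w)) \<in> ?N"
      using that by (intro subsetD[OF rel], unfold tensor_relations_def Let_def) blast
    then show ?thesis
      using that gen unfolding tensor_def pure_tensor_def
      by (simp add: M.quotient_add[OF sub] M.quotient_eq[OF sub] M.a_closed del: free_module_simps)
  qed
  have 2: "pure_tensor F V W v (w \<oplus>\<^bsub>W\<^esub> w') = pure_tensor F V W v w \<oplus>\<^bsub>tensor F V W\<^esub> pure_tensor F V W v w'"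
    if "v \<in> carrier V" "w \<in> carrier W" "w' \<in> carrier W" for v w w'
  proof -
    have "free_gen F (v, w \<oplus>\<^bsub>W\<^esub> w') \<ominus>\<^bsub>?M\<^esub> (free_gen F (v, w) \<oplus>\<^bsub>?M\<^esub> free_gen F (v, w')) \<in> ?N"
      using that by (intro subsetD[OF rel], unfold tensor_relations_def Let_def) blast
    then show ?thesis
      using that gen unfolding tensor_def pure_tensor_def
      by (simp add: M.quotient_add[OF sub] M.quotient_eq[OF sub] M.a_closed del: free_module_simps)
  qed
  have 3: "pure_tensor F V W (a \<odot>\<^bsub>V\<^esub> v) w = a \<odot>\<^bsub>tensor F V W\<^esub> pure_tensor F V W v w"
    if "a \<in> carrier F" "v \<in> carrier V" "w \<in> carrier W" for a v w
  proof -
    have "free_gen F (a \<odot>\<^bsub>V\<^esub> v, w) \<ominus>\<^bsub>?M\<^esub> (a \<odot>\<^bsub>?M\<^esub> free_gen F (v, w)) \<in> ?N"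
      using that by (intro subsetD[OF rel], unfold tensor_relations_def Let_def) blast
    then show ?thesis
      using that gen unfolding tensor_def pure_tensor_def
      by (simp add: M.quotient_smult[OF sub] M.quotient_eq[OF sub] del: free_module_simps)
  qed
  have 4: "pure_tensor F V W v (a \<odot>\<^bsub>W\<^esub> w) = a \<odot>\<^bsub>tensor F V W\<^esub> pure_tensor F V W v w"
    if "a \<in> carrier F" "v \<in> carrier V" "w \<in> carrier W" for a v w
  proof -
    have "free_gen F (v, a \<odot>\<^bsub>W\<^esub> w) \<ominus>\<^bsub>?M\<^esub> (a \<odot>\<^bsub>?M\<^esub> free_gen F (v, w)) \<in> ?N"
      using that by (intro subsetD[OF rel], unfold tensor_relations_def Let_def) blast
    then show ?thesis
      using that gen unfolding tensor_def pure_tensor_def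
      by (simp add: M.quotient_smult[OF sub] M.quotient_eq[OF sub] del: free_module_simps)
  qed
  have 5: "pure_tensor F V W v w \<in> carrier (tensor F V W)"
    if "v \<in> carrier V" "w \<in> carrier W" for v w
    using that gen unfolding tensor_def pure_tensor_def by (auto simp: M.quotient_carrier[OF sub])
  show ?thesis
    unfolding bilinear_map_def module_hom_def by (simp add: 1 2 3 4 5 Pi_iff)
qed

theorem tensor_universal:
  assumes "module F V" "module F W" "module F U" and h: "bilinear_map F V W U h"
  shows "\<exists>!\<phi>. \<phi> \<in> extensional (carrier (tensor F V W)) \<and> \<phi> \<in> module_hom F (tensor F V W) U \<and>
           (\<forall>v\<in>carrier V. \<forall>w\<in>carrier W. \<phi> (pure_tensor F V W v w) = h v w)"
proof -
  interpret V: module F V by fact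
  interpret W: module F W by fact
  interpret U: module F U by fact
  let ?X = "carrier V \<times> carrier W"
  let ?M = "free_module F ?X"
  let ?N = "tensor_kernel F V W"
  interpret M: module F ?M by (rule V.free_module_is_module)
  note sub = tensor_kernel_submodule[OF assms(1,2)]
  have gen: "free_gen F (v, w) \<in> carrier ?M" if "v \<in> carrier V" "w \<in> carrier W" for v w
    using that by (intro V.free_gen_closed) auto
  have hcl: "h v w \<in> carrier U" if "v \<in> carrier V" "w \<in> carrier W" for v w
    using h that by (auto simp: bilinear_map_def module_hom_def)
  have hl: "h (v \<oplus>\<^bsub>V\<^esub> v') w = h v w \<oplus>\<^bsub>U\<^esub> h v' w" "h (a \<odot>\<^bsub>V\<^esub> v) w = a \<odot>\<^bsub>U\<^esub> h v w"
    if "v \<in> carrier V" "v' \<in> carrier V" "w \<in> carrier W" "a \<in> carrier F" for v v' w a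
    using h that by (auto simp: bilinear_map_def module_hom_def)
  have ha: "h (v \<oplus>\<^bsub>V\<^esub> v') w = h v w \<oplus>\<^bsub>U\<^esub> h v' w"
    if "v \<in> carrier V" "v' \<in> carrier V" "w \<in> carrier W" for v v' w
    using h that by (auto simp: bilinear_map_def module_hom_def)
  have hb: "h v (w \<oplus>\<^bsub>W\<^esub> w') = h v w \<oplus>\<^bsub>U\<^esub> h v w'"
    if "v \<in> carrier V" "w' \<in> carrier W" "w \<in> carrier W" for v w w'
    using h that by (auto simp: bilinear_map_def module_hom_def)
  have hr: "h v (w \<oplus>\<^bsub>W\<^esub> w') = h v w \<oplus>\<^bsub>U\<^esub> h v w'" "h v (a \<odot>\<^bsub>W\<^esub> w) = a \<odot>\<^bsub>U\<^esub> h v w"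
    if "v \<in> carrier V" "w' \<in> carrier W" "w \<in> carrier W" "a \<in> carrier F" for v w w' a
    using h that by (auto simp: bilinear_map_def module_hom_def)
  obtain g where g: "g \<in> module_hom F ?M U" and gg: "\<And>v w. v \<in> carrier V \<Longrightarrow> w \<in> carrier W \<Longrightarrow> g (free_gen F (v, w)) = h v w"
    using U.free_lift[of "\<lambda>(v, w). h v w" ?X] hcl by (auto simp: Pi_iff)
  interpret g: mod_hom F ?M U g
    by (simp add: mod_hom_def mod_hom_axioms_def g U.module_axioms M.module_axioms)
  have "tensor_relations F V W \<subseteq> g.ker"
  proof
    fix r assume r: "r \<in> tensor_relations F V W"
    then have rc: "r \<in> carrier ?M" using tensor_relations_closed[OF assms(1,2)] by blast
    have "g r = \<zero>\<^bsub>U\<^esub>"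
      using r unfolding tensor_relations_def Let_def
      by (auto simp del: free_module_simps simp: gen gg M.a_closed M.smult_closed ha hb hl hr hcl g.f_minus
          V.a_closed W.a_closed V.smult_closed W.smult_closed U.minus_eq U.r_neg)
    then show "r \<in> g.ker" using rc by (simp add: g.ker_def)
  qed
  then have "?N \<subseteq> g.ker"
    unfolding tensor_kernel_def by (intro M.span_is_subset g.ker_is_submodule)
  then obtain \<psi> where \<psi>: "\<psi> \<in> module_hom F (tensor F V W) U" "\<And>t. t \<in> carrier ?M \<Longrightarrow> \<psi> (?N +>\<^bsub>?M\<^esub> t) = g t"
    using M.quotient_lift[OF sub assms(3) g] by (auto simp: tensor_def g.ker_def subset_iff)
  let ?\<phi> = "restrict \<psi> (carrier (tensor F V W))"
  have T: "module F (tensor F V W)" by (rule tensor_module[OF assms(1,2)])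
  interpret T: module F "tensor F V W" by fact
  show ?thesis
  proof (rule ex1I[of _ ?\<phi>])
    have "?\<phi> \<in> module_hom F (tensor F V W) U" using \<psi>(1) by (auto simp: module_hom_def)
    moreover have "?\<phi> (pure_tensor F V W v w) = h v w" if "v \<in> carrier V" "w \<in> carrier W" for v w
      using that \<psi>(2)[OF gen[OF that]] gg[OF that] gen[OF that]
      by (auto simp: pure_tensor_def tensor_def M.quotient_carrier[OF sub])
    ultimately show "?\<phi> \<in> extensional (carrier (tensor F V W)) \<and> ?\<phi> \<in> module_hom F (tensor F V W) U \<and>
           (\<forall>v\<in>carrier V. \<forall>w\<in>carrier W. ?\<phi> (pure_tensor F V W v w) = h v w)" by simp
  next
    fix \<chi> assume \<chi>: "\<chi> \<in> extensional (carrier (tensor F V W)) \<and> \<chi> \<in> module_hom F (tensor F V W) U \<and>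
           (\<forall>v\<in>carrier V. \<forall>w\<in>carrier W. \<chi> (pure_tensor F V W v w) = h v w)"
    define c where "c = (\<lambda>t. \<chi> (?N +>\<^bsub>?M\<^esub> t))"
    have ch: "c \<in> module_hom F ?M U"
      unfolding module_hom_def
    proof safe
      fix t assume "t \<in> carrier ?M"
      then show "c t \<in> carrier U" unfolding c_def using \<chi> by (auto simp: module_hom_def tensor_def M.quotient_carrier[OF sub])
    next
      fix s t assume st: "s \<in> carrier ?M" "t \<in> carrier ?M"
      then have "?N +>\<^bsub>?M\<^esub> (s \<oplus>\<^bsub>?M\<^esub> t) = (?N +>\<^bsub>?M\<^esub> s) \<oplus>\<^bsub>tensor F V W\<^esub> (?N +>\<^bsub>?M\<^esub> t)"
        by (simp add: tensor_def M.quotient_add[OF sub] del: free_module_simps)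
      moreover have "?N +>\<^bsub>?M\<^esub> s \<in> carrier (tensor F V W)" "?N +>\<^bsub>?M\<^esub> t \<in> carrier (tensor F V W)"
        using st by (auto simp: tensor_def M.quotient_carrier[OF sub])
      ultimately show "c (s \<oplus>\<^bsub>?M\<^esub> t) = c s \<oplus>\<^bsub>U\<^esub> c t" unfolding c_def using \<chi> module_hom_add[of \<chi>] by metis
    next
      fix a t assume st: "a \<in> carrier F" "t \<in> carrier ?M"
      then have "?N +>\<^bsub>?M\<^esub> (a \<odot>\<^bsub>?M\<^esub> t) = a \<odot>\<^bsub>tensor F V W\<^esub> (?N +>\<^bsub>?M\<^esub> t)"
        by (simp add: tensor_def M.quotient_smult[OF sub] del: free_module_simps)
      moreover have "?N +>\<^bsub>?M\<^esub> t \<in> carrier (tensor F V W)"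
        using st by (auto simp: tensor_def M.quotient_carrier[OF sub])
      ultimately show "c (a \<odot>\<^bsub>?M\<^esub> t) = a \<odot>\<^bsub>U\<^esub> c t" unfolding c_def using \<chi> st module_hom_smult[of \<chi>] by metis
    qed
    have eq: "c t = g t" if "t \<in> carrier ?M" for t
      by (rule U.free_hom_eqI[OF ch g _ that]) (use gg \<chi> in \<open>auto simp: c_def pure_tensor_def\<close>)
    show "\<chi> = ?\<phi>"
    proof (rule extensionalityI[of _ "carrier (tensor F V W)"])
      fix x assume x: "x \<in> carrier (tensor F V W)"
      then obtain t where "t \<in> carrier ?M" "x = ?N +>\<^bsub>?M\<^esub> t" by (auto simp: tensor_def M.quotient_carrier[OF sub])
      then show "\<chi> x = ?\<phi> x" using x eq \<psi>(2) by (simp add: c_def)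
    qed (use \<chi> in auto)
  qed
qed

lemma tensor_lift:
  assumes "module F V" "module F W" "module F U" and h: "bilinear_map F V W U h"
  shows tensor_lift_hom: "tensor_lift F V W U h \<in> module_hom F (tensor F V W) U"
    and tensor_lift_pure: "\<And>v w. v \<in> carrier V \<Longrightarrow> w \<in> carrier W \<Longrightarrow>
      tensor_lift F V W U h (pure_tensor F V W v w) = h v w"
  using theI'[OF tensor_universal[OF assms]] by (auto simp: tensor_lift_def)

lemma tensor_hom_eqI:
  assumes "module F V" "module F W" "module F U"
    and f: "f \<in> module_hom F (tensor F V W) U" and g: "g \<in> module_hom F (tensor F V W) U"
    and eq: "\<And>v w. v \<in> carrier V \<Longrightarrow> w \<in> carrier W \<Longrightarrow> f (pure_tensor F V W v w) = g (pure_tensor F V W v w)"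
    and t: "t \<in> carrier (tensor F V W)"
  shows "f t = g t"
proof -
  let ?T = "carrier (tensor F V W)"
  have b: "bilinear_map F V W (tensor F V W) (pure_tensor F V W)" by (rule tensor_bilinear[OF assms(1,2)])
  have p: "pure_tensor F V W v w \<in> ?T" if "v \<in> carrier V" "w \<in> carrier W" for v w
    using b that by (auto simp: bilinear_map_def module_hom_def)
  have T: "module F (tensor F V W)" by (rule tensor_module[OF assms(1,2)])
  interpret V: module F V by fact
  interpret W: module F W by fact
  interpret T: module F "tensor F V W" by fact
  define h where "h v w = f (pure_tensor F V W v w)" for v w
  have h: "bilinear_map F V W U h"
    unfolding bilinear_map_def
  proof (intro conjI ballI)
    fix w assume w: "w \<in> carrier W"
    have "(\<lambda>v. pure_tensor F V W v w) \<in> module_hom F V (tensor F V W)"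
      using b w by (simp add: bilinear_map_def)
    then show "(\<lambda>v. h v w) \<in> module_hom F V U"
      using f p[OF _ w] unfolding h_def by (simp add: module_hom_def Pi_iff)
  next
    fix v assume v: "v \<in> carrier V"
    have "pure_tensor F V W v \<in> module_hom F W (tensor F V W)"
      using b v by (simp add: bilinear_map_def)
    then show "h v \<in> module_hom F W U"
      using f p[OF v] unfolding h_def by (simp add: module_hom_def Pi_iff)
  qed
  let ?P = "\<lambda>\<phi>. \<phi> \<in> extensional ?T \<and> \<phi> \<in> module_hom F (tensor F V W) U \<and>
           (\<forall>v\<in>carrier V. \<forall>w\<in>carrier W. \<phi> (pure_tensor F V W v w) = h v w)"
  have "?P (restrict f ?T)" "?P (restrict g ?T)"
    using f g p eq by (auto simp: module_hom_def h_def)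
  then have "restrict f ?T = restrict g ?T"
    using tensor_universal[OF assms(1-3) h] by (metis (no_types, lifting))
  then show ?thesis using t by (metis restrict_apply')
qed


lemma bilinear_mapD:
  assumes "bilinear_map F V W U h" "v \<in> carrier V" "w \<in> carrier W"
  shows bilinear_map_left: "(\<lambda>v. h v w) \<in> module_hom F V U"
    and bilinear_map_right: "h v \<in> module_hom F W U"
    and bilinear_map_closed: "h v w \<in> carrier U"
  using assms by (auto simp: bilinear_map_def module_hom_def)

lemma module_homI:
  assumes "\<And>x. x \<in> carrier V \<Longrightarrow> f x \<in> carrier W"
    and "\<And>x y. x \<in> carrier V \<Longrightarrow> y \<in> carrier V \<Longrightarrow> f (x \<oplus>\<^bsub>V\<^esub> y) = f x \<oplus>\<^bsub>W\<^esub> f y"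
    and "\<And>a x. a \<in> carrier F \<Longrightarrow> x \<in> carrier V \<Longrightarrow> f (a \<odot>\<^bsub>V\<^esub> x) = a \<odot>\<^bsub>W\<^esub> f x"
  shows "f \<in> module_hom F V W"
  using assms by (simp add: module_hom_def)

lemma module_hom_comp:
  "f \<in> module_hom F V W \<Longrightarrow> g \<in> module_hom F W U \<Longrightarrow> (\<lambda>x. g (f x)) \<in> module_hom F V U"
  by (simp add: module_hom_def Pi_iff)

lemma tensor_map:
  assumes "module F V" "module F W" "module F V'" "module F W'"
    and f: "f \<in> module_hom F V V'" and g: "g \<in> module_hom F W W'"
  shows tensor_map_hom: "tensor_map F V W V' W' f g \<in> module_hom F (tensor F V W) (tensor F V' W')"
    and tensor_map_pure: "\<And>v w. v \<in> carrier V \<Longrightarrow> w \<in> carrier W \<Longrightarrow>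
      tensor_map F V W V' W' f g (pure_tensor F V W v w) = pure_tensor F V' W' (f v) (g w)"
proof -
  note b = tensor_bilinear[OF assms(3,4)]
  have fc: "f v \<in> carrier V'" if "v \<in> carrier V" for v using f that by (auto simp: module_hom_def)
  have gc: "g v \<in> carrier W'" if "v \<in> carrier W" for v using g that by (auto simp: module_hom_def)
  have "bilinear_map F V W (tensor F V' W') (\<lambda>v w. pure_tensor F V' W' (f v) (g w))"
    unfolding bilinear_map_def
  proof (intro conjI ballI)
    fix w assume "w \<in> carrier W"
    then show "(\<lambda>v. pure_tensor F V' W' (f v) (g w)) \<in> module_hom F V (tensor F V' W')"
      using b gc by (intro module_hom_comp[OF f, of "\<lambda>v. pure_tensor F V' W' v (g w)"]) (auto simp: bilinear_map_def)
  next
    fix v assume "v \<in> carrier V"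
    then show "(\<lambda>w. pure_tensor F V' W' (f v) (g w)) \<in> module_hom F W (tensor F V' W')"
      using b fc by (intro module_hom_comp[OF g]) (auto simp: bilinear_map_def)
  qed
  from tensor_lift[OF assms(1,2) tensor_module[OF assms(3,4)] this]
  show "tensor_map F V W V' W' f g \<in> module_hom F (tensor F V W) (tensor F V' W')"
    and "\<And>v w. v \<in> carrier V \<Longrightarrow> w \<in> carrier W \<Longrightarrow>
      tensor_map F V W V' W' f g (pure_tensor F V W v w) = pure_tensor F V' W' (f v) (g w)"
    by (simp_all add: tensor_map_def)
qed

lemma tensor_assoc:
  assumes U: "module F U" and V: "module F V" and W: "module F W"
  shows tensor_assoc_hom: "tensor_assoc F U V W \<in> module_hom F (tensor F (tensor F U V) W) (tensor F U (tensor F V W))"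
    and tensor_assoc_pure: "\<And>u v w. u \<in> carrier U \<Longrightarrow> v \<in> carrier V \<Longrightarrow> w \<in> carrier W \<Longrightarrow>
      tensor_assoc F U V W (pure_tensor F (tensor F U V) W (pure_tensor F U V u v) w) =
        pure_tensor F U (tensor F V W) u (pure_tensor F V W v w)"
proof -
  let ?T = "tensor F U (tensor F V W)"
  let ?p = "\<lambda>w u v. pure_tensor F U (tensor F V W) u (pure_tensor F V W v w)"
  let ?L = "\<lambda>t w. tensor_lift F U V ?T (?p w) t"
  note UV = tensor_module[OF U V] and VW = tensor_module[OF V W]
  note T = tensor_module[OF U VW]
  interpret U: module F U by fact
  interpret V: module F V by fact
  interpret W: module F W by fact
  interpret UV: module F "tensor F U V" by fact
  interpret T: module F ?T by fact
  note b1 = tensor_bilinear[OF V W] and b2 = tensor_bilinear[OF U VW] and b3 = tensor_bilinear[OF U V]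
  note c1 = bilinear_map_closed[OF b1]
  have bp: "bilinear_map F U V ?T (?p w)" if w: "w \<in> carrier W" for w
    unfolding bilinear_map_def
  proof (intro conjI ballI)
    fix v assume v: "v \<in> carrier V"
    show "(\<lambda>u. ?p w u v) \<in> module_hom F U ?T"
      using b2 c1[OF v w] by (simp add: bilinear_map_def)
  next
    fix u assume u: "u \<in> carrier U"
    show "?p w u \<in> module_hom F V ?T"
      by (rule module_hom_comp[of "\<lambda>v. pure_tensor F V W v w" F V "tensor F V W" "pure_tensor F U (tensor F V W) u"])
         (use b1 b2 u w in \<open>simp_all add: bilinear_map_def\<close>)
  qed
  note L = tensor_lift[OF U V T bp]
  have add_hom: "(\<lambda>t. f t \<oplus>\<^bsub>?T\<^esub> g t) \<in> module_hom F (tensor F U V) ?T"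
    if "f \<in> module_hom F (tensor F U V) ?T" "g \<in> module_hom F (tensor F U V) ?T" for f g
    using that by (auto simp: module_hom_def Pi_iff T.a_ac T.smult_r_distr)
  have smult_hom: "(\<lambda>t. a \<odot>\<^bsub>?T\<^esub> f t) \<in> module_hom F (tensor F U V) ?T"
    if "f \<in> module_hom F (tensor F U V) ?T" "a \<in> carrier F" for f a
    using that by (auto simp: module_hom_def Pi_iff T.smult_r_distr T.smult_assoc1[symmetric] U.m_comm)
  have p_right: "(\<lambda>w. ?p w u v) \<in> module_hom F W ?T" if "u \<in> carrier U" "v \<in> carrier V" for u v
    by (rule module_hom_comp[of "pure_tensor F V W v" F W "tensor F V W" "pure_tensor F U (tensor F V W) u"])
       (use b1 b2 that in \<open>simp_all add: bilinear_map_def\<close>)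
  have "bilinear_map F (tensor F U V) W ?T ?L"
    unfolding bilinear_map_def
  proof (intro conjI ballI)
    show "(\<lambda>t. ?L t w) \<in> module_hom F (tensor F U V) ?T" if "w \<in> carrier W" for w
      using L(1)[OF that] .
  next
    fix t assume t: "t \<in> carrier (tensor F U V)"
    show "?L t \<in> module_hom F W ?T"
    proof (rule module_homI)
      fix w assume w: "w \<in> carrier W"
      show "?L t w \<in> carrier ?T" using L(1)[OF w] t by (auto simp: module_hom_def)
    next
      fix w w' assume w: "w \<in> carrier W" and w': "w' \<in> carrier W"
      have ww: "w \<oplus>\<^bsub>W\<^esub> w' \<in> carrier W" using w w' by simp
      have "?L t (w \<oplus>\<^bsub>W\<^esub> w') = (\<lambda>t. ?L t w \<oplus>\<^bsub>?T\<^esub> ?L t w') t"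
      proof (rule tensor_hom_eqI[OF U V T L(1)[OF ww] add_hom[OF L(1)[OF w] L(1)[OF w']] _ t])
        fix u v assume "u \<in> carrier U" "v \<in> carrier V"
        then show "?L (pure_tensor F U V u v) (w \<oplus>\<^bsub>W\<^esub> w') =
            ?L (pure_tensor F U V u v) w \<oplus>\<^bsub>?T\<^esub> ?L (pure_tensor F U V u v) w'"
          using module_hom_add[OF p_right w w'] by (simp add: L(2) w w')
      qed
      then show "?L t (w \<oplus>\<^bsub>W\<^esub> w') = ?L t w \<oplus>\<^bsub>?T\<^esub> ?L t w'" by simp
    next
      fix a w assume a: "a \<in> carrier F" and w: "w \<in> carrier W"
      have ww: "a \<odot>\<^bsub>W\<^esub> w \<in> carrier W" using a w by simp
      have "?L t (a \<odot>\<^bsub>W\<^esub> w) = (\<lambda>t. a \<odot>\<^bsub>?T\<^esub> ?L t w) t"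
      proof (rule tensor_hom_eqI[OF U V T L(1)[OF ww] smult_hom[OF L(1)[OF w] a] _ t])
        fix u v assume "u \<in> carrier U" "v \<in> carrier V"
        then show "?L (pure_tensor F U V u v) (a \<odot>\<^bsub>W\<^esub> w) = a \<odot>\<^bsub>?T\<^esub> ?L (pure_tensor F U V u v) w"
          using module_hom_smult[OF p_right a w] by (simp add: L(2) a w)
      qed
      then show "?L t (a \<odot>\<^bsub>W\<^esub> w) = a \<odot>\<^bsub>?T\<^esub> ?L t w" by simp
    qed
  qed
  note M = tensor_lift[OF UV W T this]
  show "tensor_assoc F U V W \<in> module_hom F (tensor F (tensor F U V) W) (tensor F U (tensor F V W))"
    using M(1) by (simp add: tensor_assoc_def)
  fix u v w assume a: "u \<in> carrier U" "v \<in> carrier V" "w \<in> carrier W"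
  show "tensor_assoc F U V W (pure_tensor F (tensor F U V) W (pure_tensor F U V u v) w) =
        pure_tensor F U (tensor F V W) u (pure_tensor F V W v w)"
    using M(2)[OF bilinear_map_closed[OF b3 a(1,2)] a(3)] L(2)[OF a(3,1,2)] by (simp add: tensor_assoc_def)
qed

declare free_module_simps [simp del]

section \<open>Hom-tridendriform coalgebras\<close>

text \<open>
  The two sides of each coalgebra axiom live in \<open>(C \<otimes> C) \<otimes> C\<close> and \<open>C \<otimes> (C \<otimes> C)\<close>; they are compared
  in the latter space, so \<open>D \<otimes> \<alpha>\<close> is followed by \<^const>\<open>tensor_assoc\<close>.
\<close>

definition comult_left ::
  "('f, 'm) ring_scheme \<Rightarrow> ('f, 'c, 'n) module_scheme
    \<Rightarrow> ('c \<Rightarrow> ('c \<times> 'c \<Rightarrow> 'f) set) \<Rightarrow> ('c \<Rightarrow> 'c)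
    \<Rightarrow> ('c \<times> 'c \<Rightarrow> 'f) set \<Rightarrow> ('c \<times> ('c \<times> 'c \<Rightarrow> 'f) set \<Rightarrow> 'f) set"
  where "comult_left F C D \<alpha> t = tensor_assoc F C C C (tensor_map F C C (tensor F C C) C D \<alpha> t)"

definition comult_right ::
  "('f, 'm) ring_scheme \<Rightarrow> ('f, 'c, 'n) module_scheme
    \<Rightarrow> ('c \<Rightarrow> 'c) \<Rightarrow> ('c \<Rightarrow> ('c \<times> 'c \<Rightarrow> 'f) set)
    \<Rightarrow> ('c \<times> 'c \<Rightarrow> 'f) set \<Rightarrow> ('c \<times> ('c \<times> 'c \<Rightarrow> 'f) set \<Rightarrow> 'f) set"
  where "comult_right F C \<alpha> D t = tensor_map F C C C (tensor F C C) \<alpha> D t"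

text \<open>
  \<open>\<Delta>l\<close>, \<open>\<Delta>z\<close>, \<open>\<Delta>r\<close> stand for the comultiplications with index \<open>-1\<close>, \<open>0\<close>, \<open>1\<close>.
\<close>

locale hom_tridendriform_coalgebra = C: vectorspace F C
  for F :: "('f, 'm) ring_scheme" and C :: "('f, 'c, 'n) module_scheme" +
  fixes \<Delta>l \<Delta>z \<Delta>r :: "'c \<Rightarrow> ('c \<times> 'c \<Rightarrow> 'f) set"
    and \<alpha> :: "'c \<Rightarrow> 'c"
  assumes linear_l: "linear_map F C (tensor F C C) \<Delta>l"
    and linear_z: "linear_map F C (tensor F C C) \<Delta>z"
    and linear_r: "linear_map F C (tensor F C C) \<Delta>r"
    and linear_\<alpha>: "linear_map F C C \<alpha>"
    and axiom_1: "x \<in> carrier C \<Longrightarrow>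
      comult_left F C \<Delta>l \<alpha> (\<Delta>l x) =
        comult_right F C \<alpha> \<Delta>l (\<Delta>l x)
          \<oplus>\<^bsub>tensor F C (tensor F C C)\<^esub> comult_right F C \<alpha> \<Delta>r (\<Delta>l x)
          \<oplus>\<^bsub>tensor F C (tensor F C C)\<^esub> comult_right F C \<alpha> \<Delta>z (\<Delta>l x)"
    and axiom_2: "x \<in> carrier C \<Longrightarrow>
      comult_left F C \<Delta>r \<alpha> (\<Delta>l x) = comult_right F C \<alpha> \<Delta>l (\<Delta>r x)"
    and axiom_3: "x \<in> carrier C \<Longrightarrow>
      comult_right F C \<alpha> \<Delta>r (\<Delta>r x) =
        comult_left F C \<Delta>l \<alpha> (\<Delta>r x)
          \<oplus>\<^bsub>tensor F C (tensor F C C)\<^esub> comult_left F C \<Delta>r \<alpha> (\<Delta>r x)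
          \<oplus>\<^bsub>tensor F C (tensor F C C)\<^esub> comult_left F C \<Delta>z \<alpha> (\<Delta>r x)"
    and axiom_4: "x \<in> carrier C \<Longrightarrow>
      comult_left F C \<Delta>l \<alpha> (\<Delta>z x) = comult_right F C \<alpha> \<Delta>r (\<Delta>z x)"
    and axiom_5: "x \<in> carrier C \<Longrightarrow>
      comult_left F C \<Delta>r \<alpha> (\<Delta>z x) = comult_right F C \<alpha> \<Delta>z (\<Delta>r x)"
    and axiom_6: "x \<in> carrier C \<Longrightarrow>
      comult_left F C \<Delta>z \<alpha> (\<Delta>l x) = comult_right F C \<alpha> \<Delta>l (\<Delta>z x)"
    and axiom_7: "x \<in> carrier C \<Longrightarrow>
      comult_left F C \<Delta>z \<alpha> (\<Delta>z x) = comult_right F C \<alpha> \<Delta>z (\<Delta>z x)"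

definition hom_tridendriform_endomorphism ::
  "('f, 'm) ring_scheme \<Rightarrow> ('f, 'c, 'n) module_scheme
    \<Rightarrow> ('c \<Rightarrow> ('c \<times> 'c \<Rightarrow> 'f) set) \<Rightarrow> ('c \<Rightarrow> ('c \<times> 'c \<Rightarrow> 'f) set) \<Rightarrow> ('c \<Rightarrow> ('c \<times> 'c \<Rightarrow> 'f) set)
    \<Rightarrow> ('c \<Rightarrow> 'c) \<Rightarrow> ('c \<Rightarrow> 'c) \<Rightarrow> bool"
  where "hom_tridendriform_endomorphism F C \<Delta>l \<Delta>z \<Delta>r \<alpha> \<beta> \<longleftrightarrow>
    linear_map F C C \<beta> \<and>
    (\<forall>x\<in>carrier C. \<beta> (\<alpha> x) = \<alpha> (\<beta> x)) \<and>
    (\<forall>\<Delta>\<in>{\<Delta>l, \<Delta>z, \<Delta>r}. \<forall>x\<in>carrier C. \<Delta> (\<beta> x) = tensor_map F C C C C \<beta> \<beta> (\<Delta> x))"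

end

theory Submission
  imports Defs
begin

text \<open>
  Since \<open>\<Delta>\<beta> = (\<beta> \<otimes> \<beta>)\<Delta>\<close> and \<open>\<otimes>\<close> is functorial, \<open>\<Delta>\<beta> \<otimes> \<beta>\<alpha>\<close> and \<open>\<beta>\<alpha> \<otimes> \<Delta>\<beta>\<close> are the composites of
  \<open>\<Delta> \<otimes> \<alpha>\<close> and \<open>\<alpha> \<otimes> \<Delta>\<close> with \<open>\<beta> \<otimes> \<beta> \<otimes> \<beta>\<close>, which is compatible with the associativity isomorphism.
  Hence each twisted axiom at \<open>x\<close> is the image under \<open>\<beta> \<otimes> \<beta> \<otimes> \<beta>\<close> of the original axiom at \<open>\<beta> x\<close>.
\<close>

lemma module_hom_closed: "f \<in> module_hom F V W \<Longrightarrow> v \<in> carrier V \<Longrightarrow> f v \<in> carrier W"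
  by (auto simp: module_hom_def)

text \<open>The hypotheses of the theorem are phrased with \<open>linear_map\<close>, while the
  tensor product lemmas expect members of \<open>module_hom\<close>; this equivalence translates in
  both directions.\<close>

lemma linear_map_iff:
  "linear_map F V W f \<longleftrightarrow> vectorspace F V \<and> vectorspace F W \<and> f \<in> module_hom F V W"
  by (auto simp: linear_map_def mod_hom_def mod_hom_axioms_def vectorspace_def)

text \<open>Both sides are linear in \<open>t\<close> and agree on pure tensors, which determine a
  linear map out of a tensor product. The maps \<open>h\<close> and \<open>k\<close> are separate
  variables, equal to the composites on the carriers only, because \<open>D (\<beta> x)\<close> is
  known only for \<open>x\<close> in the carrier.\<close>

lemma tensor_map_comp:
  assumes m: "module F V" "module F W" "module F V'" "module F W'" "module F V''" "module F W''"
    and f: "f \<in> module_hom F V V'" and g: "g \<in> module_hom F W W'"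
    and f': "f' \<in> module_hom F V' V''" and g': "g' \<in> module_hom F W' W''"
    and h: "h \<in> module_hom F V V''" "\<And>v. v \<in> carrier V \<Longrightarrow> h v = f' (f v)"
    and k: "k \<in> module_hom F W W''" "\<And>w. w \<in> carrier W \<Longrightarrow> k w = g' (g w)"
    and t: "t \<in> carrier (tensor F V W)"
  shows "tensor_map F V W V'' W'' h k t
    = tensor_map F V' W' V'' W'' f' g' (tensor_map F V W V' W' f g t)"
proof (rule tensor_hom_eqI[OF m(1,2) tensor_module[OF m(5,6)] _ _ _ t])
  note T = tensor_map[OF m(1-4) f g] and T' = tensor_map[OF m(3-6) f' g']
    and hk = tensor_map[OF m(1,2,5,6) h(1) k(1)]
  show "tensor_map F V W V'' W'' h k \<in> module_hom F (tensor F V W) (tensor F V'' W'')"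
    by (rule hk(1))
  show "(\<lambda>t. tensor_map F V' W' V'' W'' f' g' (tensor_map F V W V' W' f g t))
      \<in> module_hom F (tensor F V W) (tensor F V'' W'')"
    by (rule module_hom_comp[OF T(1) T'(1)])
  show "tensor_map F V W V'' W'' h k (pure_tensor F V W v w)
      = tensor_map F V' W' V'' W'' f' g' (tensor_map F V W V' W' f g (pure_tensor F V W v w))"
    if "v \<in> carrier V" "w \<in> carrier W" for v w
    using that by (simp add: hk(2) T(2) T'(2) h(2) k(2) module_hom_closed[OF f] module_hom_closed[OF g])
qed

text \<open>Both composites send \<open>(u \<otimes> v) \<otimes> w\<close> to
  \<open>f u \<otimes> (g v \<otimes> h w)\<close>. The reduction to such elements takes two rounds,
  since the left factor of a pure tensor of the outer product is an arbitrary element of the inner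
  one.\<close>

lemma tensor_assoc_natural:
  assumes U: "module F U" "module F U'" and V: "module F V" "module F V'"
    and W: "module F W" "module F W'"
    and f: "f \<in> module_hom F U U'" and g: "g \<in> module_hom F V V'" and h: "h \<in> module_hom F W W'"
    and t: "t \<in> carrier (tensor F (tensor F U V) W)"
  shows "tensor_assoc F U' V' W'
      (tensor_map F (tensor F U V) W (tensor F U' V') W' (tensor_map F U V U' V' f g) h t)
    = tensor_map F U (tensor F V W) U' (tensor F V' W') f (tensor_map F V W V' W' g h)
        (tensor_assoc F U V W t)" (is "?l t = ?r t")
proof (rule tensor_hom_eqI[OF _ W(1) _ _ _ _ t])
  let ?T = "tensor F U' (tensor F V' W')"
  note UV = tensor_module[OF U(1) V(1)] and UV' = tensor_module[OF U(2) V(2)]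
    and VW = tensor_module[OF V(1) W(1)] and VW' = tensor_module[OF V(2) W(2)]
  note fg = tensor_map[OF U(1) V(1) U(2) V(2) f g] and gh = tensor_map[OF V(1) W(1) V(2) W(2) g h]
  note fg_h = tensor_map[OF UV W(1) UV' W(2) fg(1) h]
    and f_gh = tensor_map[OF U(1) VW U(2) VW' f gh(1)]
  note a = tensor_assoc[OF U(1) V(1) W(1)] and a' = tensor_assoc[OF U(2) V(2) W(2)]
  note b = tensor_bilinear[OF UV W(1)]
  show "module F (tensor F U V)" by (rule UV)
  show T: "module F ?T" by (rule tensor_module[OF U(2) VW'])
  show l: "?l \<in> module_hom F (tensor F (tensor F U V) W) ?T"
    by (rule module_hom_comp[OF fg_h(1) a'(1)])
  show r: "?r \<in> module_hom F (tensor F (tensor F U V) W) ?T"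
    by (rule module_hom_comp[OF a(1) f_gh(1)])
  fix s w assume s: "s \<in> carrier (tensor F U V)" and w: "w \<in> carrier W"
  \<comment> \<open>For fixed \<open>w\<close>, composing with this linear map makes both sides
    linear in \<open>s\<close>, so uniqueness applies a second time, now on the inner
    product.\<close>
  have p: "(\<lambda>s. pure_tensor F (tensor F U V) W s w) \<in> module_hom F (tensor F U V) (tensor F (tensor F U V) W)"
    using b w by (simp add: bilinear_map_def)
  show "?l (pure_tensor F (tensor F U V) W s w) = ?r (pure_tensor F (tensor F U V) W s w)"
  proof (rule tensor_hom_eqI[OF U(1) V(1) T module_hom_comp[OF p l] module_hom_comp[OF p r] _ s])
    fix u v assume "u \<in> carrier U" "v \<in> carrier V"
    then show "?l (pure_tensor F (tensor F U V) W (pure_tensor F U V u v) w)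
        = ?r (pure_tensor F (tensor F U V) W (pure_tensor F U V u v) w)"
      using w
      by (simp add: fg(2) gh(2) fg_h(2) f_gh(2) a(2) a'(2)
          module_hom_closed[OF f] module_hom_closed[OF g] module_hom_closed[OF h]
          bilinear_map_closed[OF tensor_bilinear[OF U(1) V(1)]]
          bilinear_map_closed[OF tensor_bilinear[OF V(1) W(1)]])
  qed
qed

text \<open>\<open>B\<close> is \<beta> \<otimes> \<beta> \<otimes> \<beta>, bracketed as acts on
  the space where the axioms are compared. Twisting all structure maps by \<beta> then amounts to
  applying \<open>B\<close> afterwards, on either side of an axiom.\<close>

lemma comult_twist:
  assumes C: "module F C"
    and D: "D \<in> module_hom F C (tensor F C C)"
    and \<alpha>: "\<alpha> \<in> module_hom F C C" and \<beta>: "\<beta> \<in> module_hom F C C"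
    and D\<beta>: "\<And>x. x \<in> carrier C \<Longrightarrow> D (\<beta> x) = tensor_map F C C C C \<beta> \<beta> (D x)"
    and t: "t \<in> carrier (tensor F C C)"
  defines "B \<equiv> tensor_map F C (tensor F C C) C (tensor F C C) \<beta> (tensor_map F C C C C \<beta> \<beta>)"
  shows comult_left_twist: "comult_left F C (D \<circ> \<beta>) (\<beta> \<circ> \<alpha>) t = B (comult_left F C D \<alpha> t)"
    and comult_right_twist: "comult_right F C (\<beta> \<circ> \<alpha>) (D \<circ> \<beta>) t = B (comult_right F C \<alpha> D t)"
    and comult_left_closed: "comult_left F C D \<alpha> t \<in> carrier (tensor F C (tensor F C C))"
    and comult_right_closed: "comult_right F C \<alpha> D t \<in> carrier (tensor F C (tensor F C C))"
proof -
  note CC = tensor_module[OF C C]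
  note \<beta>\<beta> = tensor_map_hom[OF C C C C \<beta> \<beta>]
  have D': "D \<circ> \<beta> \<in> module_hom F C (tensor F C C)" and \<alpha>': "\<beta> \<circ> \<alpha> \<in> module_hom F C C"
    unfolding comp_def by (rule module_hom_comp[OF \<beta> D], rule module_hom_comp[OF \<alpha> \<beta>])
  note D\<alpha> = module_hom_closed[OF tensor_map_hom[OF C C CC C D \<alpha>] t]
  show "comult_left F C D \<alpha> t \<in> carrier (tensor F C (tensor F C C))"
    unfolding comult_left_def by (rule module_hom_closed[OF tensor_assoc_hom[OF C C C] D\<alpha>])
  show "comult_right F C \<alpha> D t \<in> carrier (tensor F C (tensor F C C))"
    unfolding comult_right_def by (rule module_hom_closed[OF tensor_map_hom[OF C C C CC \<alpha> D] t])
  \<comment> \<open>By \<open>D\<beta>\<close>, the map \<open>D \<circ> \<beta>\<close> is also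
    \<open>D\<close> followed by \<beta> \<otimes> \<beta>; this factorization puts every \<beta>
    last.\<close>
  have "tensor_map F C C (tensor F C C) C (D \<circ> \<beta>) (\<beta> \<circ> \<alpha>) t
      = tensor_map F (tensor F C C) C (tensor F C C) C (tensor_map F C C C C \<beta> \<beta>) \<beta>
          (tensor_map F C C (tensor F C C) C D \<alpha> t)"
    by (rule tensor_map_comp[OF C C CC C CC C D \<alpha> \<beta>\<beta> \<beta> D' _ \<alpha>' _ t]) (simp_all add: D\<beta>)
  \<comment> \<open>Naturality carries \<open>(\<beta> \<otimes> \<beta>) \<otimes> \<beta>\<close>
    through the associativity map, where it becomes \<open>B\<close>.\<close>
  then show "comult_left F C (D \<circ> \<beta>) (\<beta> \<circ> \<alpha>) t = B (comult_left F C D \<alpha> t)"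
    by (simp add: comult_left_def B_def tensor_assoc_natural[OF C C C C C C \<beta> \<beta> \<beta> D\<alpha>])
  show "comult_right F C (\<beta> \<circ> \<alpha>) (D \<circ> \<beta>) t = B (comult_right F C \<alpha> D t)"
    unfolding comult_right_def B_def
    by (rule tensor_map_comp[OF C C C CC C CC \<alpha> D \<beta> \<beta>\<beta> \<alpha>' _ D' _ t]) (simp_all add: D\<beta>)
qed

theorem theorem3p7:
  fixes F :: "('f, 'm) ring_scheme" and C :: "('f, 'c, 'n) module_scheme"
    and \<Delta>l \<Delta>z \<Delta>r :: "'c \<Rightarrow> ('c \<times> 'c \<Rightarrow> 'f) set"
    and \<alpha> \<beta> :: "'c \<Rightarrow> 'c"
  assumes "field F"
    and char_0: "\<And>n :: nat. n > 0 \<Longrightarrow> [n] \<cdot>\<^bsub>F\<^esub> \<one>\<^bsub>F\<^esub> \<noteq> \<zero>\<^bsub>F\<^esub>"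
    and "hom_tridendriform_coalgebra F C \<Delta>l \<Delta>z \<Delta>r \<alpha>"
    and "hom_tridendriform_endomorphism F C \<Delta>l \<Delta>z \<Delta>r \<alpha> \<beta>"
  shows "hom_tridendriform_coalgebra F C (\<Delta>l \<circ> \<beta>) (\<Delta>z \<circ> \<beta>) (\<Delta>r \<circ> \<beta>) (\<beta> \<circ> \<alpha>)"
proof -
  interpret H: hom_tridendriform_coalgebra F C \<Delta>l \<Delta>z \<Delta>r \<alpha> by fact
  have C: "module F C" and VC: "vectorspace F C" by unfold_locales
  note CC = tensor_module[OF C C]
  note B\<Delta> = assms(4)[unfolded hom_tridendriform_endomorphism_def linear_map_iff]
  have \<beta>: "\<beta> \<in> module_hom F C C" using B\<Delta> by blast
  have \<alpha>: "\<alpha> \<in> module_hom F C C" using H.linear_\<alpha> by (simp add: linear_map_iff)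
  have l: "\<Delta>l \<in> module_hom F C (tensor F C C)" and z: "\<Delta>z \<in> module_hom F C (tensor F C C)"
    and r: "\<Delta>r \<in> module_hom F C (tensor F C C)"
    using H.linear_l H.linear_z H.linear_r by (simp_all add: linear_map_iff)
  have l\<beta>: "\<Delta>l (\<beta> x) = tensor_map F C C C C \<beta> \<beta> (\<Delta>l x)"
    and z\<beta>: "\<Delta>z (\<beta> x) = tensor_map F C C C C \<beta> \<beta> (\<Delta>z x)"
    and r\<beta>: "\<Delta>r (\<beta> x) = tensor_map F C C C C \<beta> \<beta> (\<Delta>r x)" if "x \<in> carrier C" for x
    using B\<Delta> that by auto
  note lt = comult_twist[OF C l \<alpha> \<beta>, OF l\<beta>] and zt = comult_twist[OF C z \<alpha> \<beta>, OF z\<beta>]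
    and rt = comult_twist[OF C r \<alpha> \<beta>, OF r\<beta>]
  let ?T = "tensor F C (tensor F C C)"
  let ?B = "tensor_map F C (tensor F C C) C (tensor F C C) \<beta> (tensor_map F C C C C \<beta> \<beta>)"
  have B: "?B \<in> module_hom F ?T ?T"
    by (rule tensor_map_hom[OF C CC C CC \<beta> tensor_map_hom[OF C C C C \<beta> \<beta>]])
  interpret T: module F ?T by (rule tensor_module[OF C CC])
  note closed = module_hom_closed[OF \<beta>] module_hom_closed[OF l] module_hom_closed[OF z]
    module_hom_closed[OF r]
  have hom_comp: "D \<circ> \<beta> \<in> module_hom F C (tensor F C C)" if "D \<in> module_hom F C (tensor F C C)" for D
    unfolding comp_def by (rule module_hom_comp[OF \<beta> that])
  have \<beta>\<alpha>: "\<beta> \<circ> \<alpha> \<in> module_hom F C C"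
    unfolding comp_def by (rule module_hom_comp[OF \<alpha> \<beta>])
  note twist = lt(1,2) zt(1,2) rt(1,2)
  note comult_closed = lt(3,4) zt(3,4) rt(3,4)
  \<comment> \<open>Axioms 1 and 3 contain sums: read from right to left, additivity collects the
    images under \<open>?B\<close> into the image of one sum, which the original axiom
    matches.\<close>
  note add = module_hom_add[OF B, symmetric]
  show ?thesis
  proof (rule hom_tridendriform_coalgebra.intro[OF VC], rule hom_tridendriform_coalgebra_axioms.intro)
  \<comment> \<open>After \<open>twist\<close>, both sides of each axiom are images under
    \<open>?B\<close>, and their arguments agree by the original axiom at
    \<open>\<beta> x\<close>.\<close>
  qed (simp_all only: linear_map_iff VC tensor_vectorspace[OF VC VC] hom_comp[OF l] hom_comp[OF z]
      hom_comp[OF r] \<beta>\<alpha> comp_apply[of _ \<beta>] twist comult_closed closed add T.a_closed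
      H.axiom_1 H.axiom_2 H.axiom_3 H.axiom_4 H.axiom_5 H.axiom_6 H.axiom_7 simp_thms)
qed

end
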